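(* Every uncountable ccc locally compact Hausdorff space (in particular, every uncountable ccc compact Hausdorff space) contains a subspace of cardinality $\aleph_1$ that is ccc in the subspace topology.
   Context: A topological space $(X,\tau)$ is ccc (has the countable chain condition) if for any uncountable $\mathcal{F}\subseteq\tau$ there are distinct $U,V\in\mathcal{F}$ with $U\cap V\neq\emptyset$. *)

theory Defs
  imports "HOL-Analysis.Analysis"
begin

unbundle cardinal_syntax

definition ccc_space :: "'a topology \<Rightarrow> bool" where
  "ccc_space X \<longleftrightarrow>
     (\<forall>\<F>. \<F> \<subseteq> {U. openin X U} \<and> uncountable \<F> \<longrightarrow>
       (\<exists>U\<in>\<F>. \<exists>V\<in>\<F>. U \<noteq> V \<and> U \<inter> V \<noteq> {}))"

(* cardSuc natLeq, the successor cardinal of natLeq, is aleph_1. *)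
definition has_card_aleph1 :: "'a set \<Rightarrow> bool" where
  "has_card_aleph1 A \<longleftrightarrow> |A| =o cardSuc natLeq"

end

theory Submission
  imports Defs
begin

text \<open>
  The subspace can be taken separable. A separable space is ccc, so it suffices to find a
  countable set \<open>D\<close> whose closure is uncountable: adding to \<open>D\<close> a set of \<open>\<aleph>\<^sub>1\<close> points of its closure
  gives the required subspace.

  There are two cases. If the isolated points are dense, they form such a \<open>D\<close>, because
  the chain condition allows only countably many of them (\<open>countable_isolated_points_if_ccc\<close>).
  Otherwise some nonempty open set \<open>U\<close> contains no isolated point, and local compactness allows a
  Cantor scheme of open sets inside \<open>U\<close>.
  Pick one point from each of the countably many sets of the scheme. Every branch has a point of the
  closure in the intersection of its sets, and a diagonal argument over the branches shows that no
  sequence lists all these points (\<open>uncountable_closure_of_countable_if_crowded\<close>).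
\<close>

section \<open>Separable subspaces and the countable chain condition\<close>

text \<open>Disjoint nonempty open sets contain different points of a countable dense set.\<close>

lemma ccc_subtopology_if_countable_dense:
  assumes "countable D" "D \<subseteq> Y" "Y \<subseteq> X closure_of D"
  shows "ccc_space (subtopology X Y)"
  unfolding ccc_space_def
proof (intro allI impI)
  fix \<F>
  assume \<F>: "\<F> \<subseteq> {U. openin (subtopology X Y) U} \<and> uncountable \<F>"
  have hits: "U \<inter> D \<noteq> {}" if "U \<in> \<F>" "U \<noteq> {}" for U
  proof -
    obtain T where T: "openin X T" "U = T \<inter> Y"
      using \<F> \<open>U \<in> \<F>\<close> by (auto simp: openin_subtopology)
    obtain x where x: "x \<in> T" "x \<in> Y"
      using T \<open>U \<noteq> {}\<close> by blast
    then obtain y where "y \<in> D" "y \<in> T"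
      using assms(3) T(1) by (meson in_closure_of subsetD)
    then show ?thesis
      using T(2) assms(2) by blast
  qed
  show "\<exists>U\<in>\<F>. \<exists>V\<in>\<F>. U \<noteq> V \<and> U \<inter> V \<noteq> {}"
  proof (rule ccontr)
    assume disj: "\<not> ?thesis"
    define p where "p U = (SOME x. x \<in> U \<inter> D)" for U
    have p: "p U \<in> U \<inter> D" if "U \<in> \<F> - {{}}" for U
      using hits[of U] that unfolding p_def some_in_eq by simp
    have "inj_on p (\<F> - {{}})"
      using p disj by (intro inj_onI) (metis Diff_iff IntD1 disjoint_iff)
    moreover have "p ` (\<F> - {{}}) \<subseteq> D"
      using p by blast
    ultimately have "countable (\<F> - {{}})"
      using \<open>countable D\<close> by (metis countable_image_inj_on countable_subset)
    then show False
      using \<F> by simp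
  qed
qed

lemma countable_isolated_points_if_ccc:
  assumes "ccc_space X"
  shows "countable {x. openin X {x}}"
proof (rule ccontr)
  let ?\<F> = "(\<lambda>x. {x}) ` {x. openin X {x}}"
  assume "\<not> ?thesis"
  then have "uncountable ?\<F>"
    using countable_image_inj_on by force
  moreover have "?\<F> \<subseteq> {U. openin X U}"
    by auto
  ultimately have "\<exists>U\<in>?\<F>. \<exists>V\<in>?\<F>. U \<noteq> V \<and> U \<inter> V \<noteq> {}"
    using assms[unfolded ccc_space_def, rule_format, of ?\<F>] by simp
  then show False
    by auto
qed

lemma countable_iff_ordLeq_natLeq: "countable A \<longleftrightarrow> |A| \<le>o natLeq"
proof -
  have "countable A \<longleftrightarrow> |A| \<le>o |UNIV :: nat set|"
    by (simp add: countable_def flip: card_of_ordLeq)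
  then show ?thesis
    using card_of_nat ordLeq_ordIso_trans ordIso_symmetric by blast
qed

lemma exists_subset_card_aleph1_if_uncountable:
  assumes "uncountable A"
  obtains B where "B \<subseteq> A" "has_card_aleph1 B"
proof -
  let ?\<kappa> = "cardSuc natLeq"
  have card: "Card_order ?\<kappa>"
    by (simp add: cardSuc_Card_order natLeq_Card_order)
  have "natLeq <o |A|"
    using assms not_ordLeq_iff_ordLess[OF natLeq_Well_order card_of_Well_order[of A]]
    by (simp add: countable_iff_ordLeq_natLeq)
  then have "?\<kappa> \<le>o |A|"
    using cardSuc_ordLess_ordLeq natLeq_Card_order card_of_Card_order by blast
  then have "|Field ?\<kappa>| \<le>o |A|"
    using card_of_Field_ordIso[OF card] ordIso_ordLeq_trans by blast
  then obtain B where "B \<subseteq> A" "|Field ?\<kappa>| =o |B|"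
    using internalize_card_of_ordLeq2[THEN iffD1] by metis
  then show ?thesis
    using that card_of_Field_ordIso[OF card] ordIso_transitive ordIso_symmetric
    unfolding has_card_aleph1_def by blast
qed

lemma has_card_aleph1_Un_countable:
  assumes "has_card_aleph1 B" "countable D"
  shows "has_card_aleph1 (D \<union> B)"
proof -
  let ?\<kappa> = "cardSuc natLeq"
  have card: "Card_order ?\<kappa>"
    by (simp add: cardSuc_Card_order natLeq_Card_order)
  have inf: "\<not> finite (Field ?\<kappa>)"
    using Field_natLeq cardSuc_finite infinite_UNIV_nat natLeq_Card_order by metis
  have "|D| \<le>o ?\<kappa>"
    using assms(2) countable_iff_ordLeq_natLeq cardSuc_ordLeq natLeq_Card_order
      ordLeq_transitive by blast
  moreover have "|B| =o ?\<kappa>"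
    using assms(1) by (simp add: has_card_aleph1_def)
  ultimately have "|D \<union> B| \<le>o ?\<kappa>"
    using card inf card_of_Un_ordLeq_infinite_Field ordIso_iff_ordLeq by blast
  moreover have "?\<kappa> \<le>o |D \<union> B|"
    using \<open>|B| =o ?\<kappa>\<close> card_of_mono1[of B "D \<union> B"] ordIso_ordLeq_trans ordIso_symmetric by blast
  ultimately show ?thesis
    unfolding has_card_aleph1_def using ordIso_iff_ordLeq by blast
qed

section \<open>A Cantor scheme in a crowded open set\<close>

text \<open>
  A crowded open set has two distinct points; they are separated by open sets, and local compactness
  shrinks these until their closures are compact and stay inside.
\<close>

lemma open_set_splits_if_crowded:
  assumes "locally_compact_space X" "Hausdorff_space X"
    and "openin X V" "V \<noteq> {}" and crowded: "\<And>x. x \<in> V \<Longrightarrow> \<not> openin X {x}"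
  obtains A B where "openin X A" "openin X B" "A \<noteq> {}" "B \<noteq> {}"
    "compactin X (X closure_of A)" "compactin X (X closure_of B)"
    "X closure_of A \<subseteq> V" "X closure_of B \<subseteq> V" "X closure_of A \<inter> X closure_of B = {}"
proof -
  have base: "neighbourhood_base_of (\<lambda>C. compactin X C \<and> closedin X C) X"
    using assms(1,2) locally_compact_Hausdorff_imp_regular_space
      locally_compact_regular_space_neighbourhood_base by blast
  have shrink: "\<exists>A. openin X A \<and> x \<in> A \<and> compactin X (X closure_of A) \<and> X closure_of A \<subseteq> W"
    if W: "openin X W" "x \<in> W" for W x
  proof -
    obtain A C where "openin X A" "compactin X C" "closedin X C" "x \<in> A" "A \<subseteq> C" "C \<subseteq> W"
      using base[unfolded neighbourhood_base_of, rule_format, of W x] W by blast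
    then have "X closure_of A \<subseteq> C"
      by (simp add: closure_of_minimal)
    moreover have "compactin X (X closure_of A)"
      using \<open>compactin X C\<close> calculation closedin_closure_of by (rule closed_compactin)
    ultimately show ?thesis
      using \<open>openin X A\<close> \<open>x \<in> A\<close> \<open>C \<subseteq> W\<close> by blast
  qed
  obtain x where "x \<in> V"
    using \<open>V \<noteq> {}\<close> by blast
  moreover have "V \<noteq> {x}"
    using crowded[OF \<open>x \<in> V\<close>] \<open>openin X V\<close> by auto
  ultimately obtain y where "y \<in> V" "x \<noteq> y"
    by blast
  then obtain S T where ST: "openin X S" "openin X T" "x \<in> S" "y \<in> T" "S \<inter> T = {}"
    using \<open>Hausdorff_space X\<close> \<open>x \<in> V\<close> openin_subset[OF \<open>openin X V\<close>]
    unfolding Hausdorff_space_def disjnt_def by (metis subsetD)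
  obtain A where A: "openin X A" "x \<in> A" "compactin X (X closure_of A)" "X closure_of A \<subseteq> V \<inter> S"
    using shrink[of "V \<inter> S" x] \<open>openin X V\<close> ST \<open>x \<in> V\<close> by auto
  obtain B where B: "openin X B" "y \<in> B" "compactin X (X closure_of B)" "X closure_of B \<subseteq> V \<inter> T"
    using shrink[of "V \<inter> T" y] \<open>openin X V\<close> ST \<open>y \<in> V\<close> by auto
  show ?thesis
    using A B ST(5) by (intro that[of A B]) auto
qed

text \<open>
  The set \<open>D\<close> consists of one point from each set of a Cantor scheme indexed by finite words over
  \<open>bool\<close>, so it is countable. By compactness, the closures along a branch share a point of the closure
  of \<open>D\<close>. If \<open>c\<^sub>0, c\<^sub>1, \<dots>\<close> listed the closure of \<open>D\<close>, the branch that turns at level \<open>n\<close> into a half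
  whose closure misses \<open>c\<^sub>n\<close> would lead to a point not in the list.
\<close>

lemma uncountable_closure_of_countable_if_crowded:
  assumes "locally_compact_space X" "Hausdorff_space X"
    and U: "openin X U" "U \<noteq> {}" and crowded: "\<And>x. x \<in> U \<Longrightarrow> \<not> openin X {x}"
  obtains D where "countable D" "D \<subseteq> topspace X" "uncountable (X closure_of D)"
proof -
  define good where "good V \<longleftrightarrow> openin X V \<and> V \<noteq> {} \<and> V \<subseteq> U" for V
  have "\<exists>H. good (H True) \<and> good (H False) \<and>
      (\<forall>b. compactin X (X closure_of (H b)) \<and> X closure_of (H b) \<subseteq> V) \<and>
      X closure_of (H True) \<inter> X closure_of (H False) = {}" if V: "good V" for V
  proof -
    have ne: "openin X V" "V \<noteq> {}" and "V \<subseteq> U"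
      using V by (auto simp: good_def)
    then have "\<And>x. x \<in> V \<Longrightarrow> \<not> openin X {x}"
      using crowded by blast
    from open_set_splits_if_crowded[OF assms(1,2) ne this]
    obtain A B where AB: "openin X A" "openin X B" "A \<noteq> {}" "B \<noteq> {}"
      "compactin X (X closure_of A)" "compactin X (X closure_of B)"
      "X closure_of A \<subseteq> V" "X closure_of B \<subseteq> V" "X closure_of A \<inter> X closure_of B = {}" .
    moreover have "A \<subseteq> X closure_of A" "B \<subseteq> X closure_of B"
      using AB(1,2) by (simp_all add: closure_of_subset openin_subset)
    ultimately show ?thesis
      using \<open>V \<subseteq> U\<close> by (intro exI[of _ "\<lambda>b. if b then A else B"]) (auto simp: good_def)
  qed
  then obtain half where half: "\<And>V. good V \<Longrightarrow> good (half V True) \<and> good (half V False) \<and>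
      (\<forall>b. compactin X (X closure_of (half V b)) \<and> X closure_of (half V b) \<subseteq> V) \<and>
      X closure_of (half V True) \<inter> X closure_of (half V False) = {}"
    by metis
  have good_half: "good (half V b)" if "good V" for V b
    using half[OF that] by (cases b) auto

  \<comment> \<open>The head of a word is the last turn taken.\<close>
  define W where "W = rec_list U (\<lambda>b _ V. half V b)"
  have W_Cons: "W (b # s) = half (W s) b" for b s
    by (simp add: W_def)
  have good_W: "good (W s)" for s
    by (induction s) (auto simp: W_def good_half, simp add: good_def U)
  define p where "p s = (SOME x. x \<in> W s)" for s
  have p: "p s \<in> W s" for s
    using good_W[of s] unfolding p_def good_def by (simp add: some_in_eq)
  define D where "D = range p"
  have "p s \<in> topspace X" for s
    using p[of s] good_W[of s] openin_subset[of X "W s"] by (auto simp: good_def)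
  then have D: "countable D" "D \<subseteq> topspace X"
    by (auto simp: D_def)

  have "uncountable (X closure_of D)"
  proof
    assume "countable (X closure_of D)"
    moreover have "X closure_of D \<noteq> {}"
      using closure_of_subset[OF D(2)] by (auto simp: D_def)
    ultimately obtain c :: "nat \<Rightarrow> 'a" where c: "range c = X closure_of D"
      by (metis range_from_nat_into)
    \<comment> \<open>The closures of the two halves are disjoint, so at most one of them contains \<open>c n\<close>.\<close>
    define w where
      "w = rec_nat [] (\<lambda>n s. (c n \<notin> X closure_of W (True # s)) # s)"
    have w_Suc: "w (Suc n) = (c n \<notin> X closure_of W (True # w n)) # w n" for n
      by (simp add: w_def)
    have avoid: "c n \<notin> X closure_of W (w (Suc n))" for n
      using half[OF good_W, of "w n"]
      by (cases "c n \<in> X closure_of W (True # w n)") (auto simp: w_Suc W_Cons)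
    define K where "K n = X closure_of W (w (Suc n))" for n
    have compact_K: "compactin X (K n)" for n
      using half[OF good_W, of "w n"] by (simp add: K_def w_Suc W_Cons)
    have W_subset_K: "W (w (Suc n)) \<subseteq> K n" for n
      using good_W by (simp add: K_def good_def closure_of_subset openin_subset)
    have "K (Suc n) \<subseteq> W (w (Suc n))" for n
      using half[OF good_W, of "w (Suc n)"] by (simp add: K_def w_Suc[of "Suc n"] W_Cons)
    then have "decseq K"
      using W_subset_K by (intro decseq_SucI) blast
    have "(\<Inter>n. K n \<inter> X closure_of D) \<noteq> {}"
    proof (rule compact_space_imp_nest)
      show "compact_space (subtopology X (K 0))"
        using compact_K by (rule compact_space_subtopology)
      show "closedin (subtopology X (K 0)) (K n \<inter> X closure_of D)" for n
        using decseqD[OF \<open>decseq K\<close>, of 0 n]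
        by (intro closedin_subset_topspace) (auto simp: K_def)
      have "p (w (Suc n)) \<in> K n \<inter> X closure_of D" for n
        using p W_subset_K closure_of_subset[OF D(2)] by (auto simp: D_def)
      then show "K n \<inter> X closure_of D \<noteq> {}" for n
        by blast
      show "decseq (\<lambda>n. K n \<inter> X closure_of D)"
        using \<open>decseq K\<close> unfolding decseq_def by blast
    qed
    then obtain x where x: "x \<in> X closure_of D" "\<And>n. x \<in> X closure_of W (w (Suc n))"
      by (auto simp: K_def)
    then obtain n where "x = c n"
      using c by (metis rangeE)
    then show False
      using avoid x(2) by blast
  qed
  with D that show ?thesis
    by blast
qed

section \<open>The subspace of cardinality \<open>\<aleph>\<^sub>1\<close>\<close>

lemma exists_countable_with_uncountable_closure:
  assumes "uncountable (topspace X)" "ccc_space X" "Hausdorff_space X" "locally_compact_space X"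
  obtains D where "countable D" "D \<subseteq> topspace X" "uncountable (X closure_of D)"
proof -
  define I where "I = {x. openin X {x}}"
  have I: "countable I" "I \<subseteq> topspace X"
    using countable_isolated_points_if_ccc[OF assms(2)] openin_subset by (auto simp: I_def)
  show ?thesis
  proof (cases "X closure_of I = topspace X")
    case True
    then show ?thesis
      using that[OF I] assms(1) by simp
  next
    case False
    let ?U = "topspace X - X closure_of I"
    have "openin X ?U"
      by (simp add: openin_diff)
    moreover have "?U \<noteq> {}"
      using False closure_of_subset_topspace[of X I] by blast
    moreover have "\<not> openin X {x}" if "x \<in> ?U" for x
      using that closure_of_subset[OF I(2)] by (auto simp: I_def)
    ultimately show ?thesis
      using uncountable_closure_of_countable_if_crowded[OF assms(4,3)] that by metis
  qed
qed

theorem corollary8: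
  fixes X :: "'a topology"
  assumes "uncountable (topspace X)"
    and "ccc_space X"
    and "Hausdorff_space X"
  shows "(locally_compact_space X \<longrightarrow>
           (\<exists>Y \<subseteq> topspace X. has_card_aleph1 Y \<and> ccc_space (subtopology X Y))) \<and>
         (compact_space X \<longrightarrow>
           (\<exists>Y \<subseteq> topspace X. has_card_aleph1 Y \<and> ccc_space (subtopology X Y)))"
proof -
  have main: "\<exists>Y \<subseteq> topspace X. has_card_aleph1 Y \<and> ccc_space (subtopology X Y)"
    if lc: "locally_compact_space X"
  proof -
    obtain D where D: "countable D" "D \<subseteq> topspace X" "uncountable (X closure_of D)"
      using exists_countable_with_uncountable_closure[OF assms lc] .
    obtain B where B: "B \<subseteq> X closure_of D" "has_card_aleph1 B"
      using exists_subset_card_aleph1_if_uncountable[OF D(3)] .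
    have sub: "D \<union> B \<subseteq> X closure_of D"
      using B(1) closure_of_subset[OF D(2)] by blast
    then have "ccc_space (subtopology X (D \<union> B))"
      using ccc_subtopology_if_countable_dense[OF D(1)] by blast
    moreover have "D \<union> B \<subseteq> topspace X"
      using sub closure_of_subset_topspace by (rule subset_trans)
    ultimately show ?thesis
      using has_card_aleph1_Un_countable[OF B(2) D(1)] by blast
  qed
  then show ?thesis
    using compact_imp_locally_compact_space by blast
qed

end
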